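(* Suppose that $\diamondsuit$ holds. Then for every cardinal $\nu\in\omega\cup\{\omega,\omega_1,2^{\omega_1}\}$ there is a normal, full, splitting tree $T\subseteq{}^{<\omega_1}\omega_1$ with exactly $\nu$ cofinal branches.
   Context: Trees $T\subseteq{}^{<\omega_1}\omega_1$ are downward closed under initial segments, of height $\omega_1$. Such $T$ is normal if for every $\sigma\in T$ and $\alpha<\omega_1$ there is $\tau\in T$ with $\sigma\sqsubseteq\tau$ and $\mathrm{dom}(\tau)\ge\alpha$; splitting if every $\sigma\in T$ has distinct $i,j$ with $\sigma^\frown i,\sigma^\frown j\in T$. A tree $T$ is full if for every limit ordinal $\beta<\mathrm{ht}(T)$ there is at most one vanishing branch of length $\beta$, i.e., at most one cofinal branch through $T$ restricted to levels below $\beta$ that has no upper bound on level $\beta$. *)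

theory Defs
  imports "HOL-Library.Countable_Set"
begin

unbundle cardinal_syntax

text \<open>
  The ordinal \<open>\<omega>\<^sub>1\<close> as a type: its elements are the countable ordinals,
  and an ordinal \<open>\<alpha> < \<omega>\<^sub>1\<close> regarded as a set is \<open>{..<\<alpha>}\<close>.
\<close>

typedef omega1 = "Field (cardSuc natLeq)"
proof -
  have "\<not> finite (Field (cardSuc natLeq))"
    using cardSuc_finite [OF natLeq_Card_order] by (simp add: Field_natLeq)
  then show ?thesis
    by (metis finite.emptyI equals0I)
qed

lemma cardSuc_natLeq_Well_order: "Well_order (cardSuc natLeq)"
  using cardSuc_Card_order [OF natLeq_Card_order] by (simp add: card_order_on_def)

instantiation omega1 :: wellorder
begin

definition less_eq_omega1 :: "omega1 \<Rightarrow> omega1 \<Rightarrow> bool" where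
  "x \<le> y \<longleftrightarrow> (Rep_omega1 x, Rep_omega1 y) \<in> cardSuc natLeq"

definition less_omega1 :: "omega1 \<Rightarrow> omega1 \<Rightarrow> bool" where
  "x < y \<longleftrightarrow> x \<le> y \<and> x \<noteq> (y :: omega1)"

instance
proof
  have wo: "well_order_on (Field (cardSuc natLeq)) (cardSuc natLeq)"
    by (rule cardSuc_natLeq_Well_order)
  then have lin: "linear_order_on (Field (cardSuc natLeq)) (cardSuc natLeq)"
    and wf: "wf (cardSuc natLeq - Id)"
    by (auto simp: well_order_on_def)
  have refl: "refl_on (Field (cardSuc natLeq)) (cardSuc natLeq)"
    and trans: "trans (cardSuc natLeq)"
    and antisym: "antisym (cardSuc natLeq)"
    and total: "total_on (Field (cardSuc natLeq)) (cardSuc natLeq)"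
    using lin by (auto simp: order_on_defs)
  fix x y z :: omega1
  show le_refl: "x \<le> x"
    using refl Rep_omega1 [of x] by (auto simp: less_eq_omega1_def refl_on_def)
  show "x \<le> z" if "x \<le> y" "y \<le> z"
    using that trans unfolding less_eq_omega1_def trans_def by blast
  show anti: "x = y" if "x \<le> y" "y \<le> x"
    using that antisym unfolding less_eq_omega1_def antisym_def
    by (metis Rep_omega1_inject)
  show "x < y \<longleftrightarrow> x \<le> y \<and> \<not> y \<le> x"
    using anti le_refl by (auto simp: less_omega1_def)
  show "x \<le> y \<or> y \<le> x"
    using total Rep_omega1 [of x] Rep_omega1 [of y] le_refl
    unfolding less_eq_omega1_def total_on_def by (metis Rep_omega1_inject)
  show "P a" if step: "\<And>x. (\<And>y. y < x \<Longrightarrow> P y) \<Longrightarrow> P x"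
    for P :: "omega1 \<Rightarrow> bool" and a
  proof -
    have "wf (inv_image (cardSuc natLeq - Id) Rep_omega1)"
      using wf by (rule wf_inv_image)
    then show ?thesis
    proof (induction a rule: wf_induct_rule)
      case (less x)
      show ?case
        by (rule step, rule less)
          (auto simp: in_inv_image less_omega1_def less_eq_omega1_def Rep_omega1_inject)
    qed
  qed
qed

end

lemma card_of_UNIV_omega1: "|UNIV :: omega1 set| =o cardSuc natLeq"
proof -
  have "bij_betw Rep_omega1 UNIV (Field (cardSuc natLeq))"
    by (metis type_definition.Rep_range type_definition_omega1 bij_betw_imageI
        Rep_omega1_inject injI)
  then have "|UNIV :: omega1 set| =o |Field (cardSuc natLeq)|"
    using card_of_ordIso by blast
  also have "|Field (cardSuc natLeq)| =o cardSuc natLeq"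
    by (rule card_of_Field_ordIso [OF cardSuc_Card_order [OF natLeq_Card_order]])
  finally show ?thesis .
qed

lemma countable_lessThan_omega1: "countable {..<\<alpha> :: omega1}"
proof -
  have "|underS (cardSuc natLeq) (Rep_omega1 \<alpha>)| <o cardSuc natLeq"
    by (rule card_of_underS [OF cardSuc_Card_order [OF natLeq_Card_order] Rep_omega1])
  then have "|underS (cardSuc natLeq) (Rep_omega1 \<alpha>)| \<le>o natLeq"
    using cardSuc_ordLeq_ordLess [OF natLeq_Card_order card_of_Card_order] by blast
  then have "|underS (cardSuc natLeq) (Rep_omega1 \<alpha>)| \<le>o |UNIV :: nat set|"
    using card_of_nat ordIso_symmetric ordLeq_ordIso_trans by blast
  then have "countable (underS (cardSuc natLeq) (Rep_omega1 \<alpha>))"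
    unfolding countable_def card_of_ordLeq [symmetric] by auto
  moreover have "Rep_omega1 ` {..<\<alpha>} \<subseteq> underS (cardSuc natLeq) (Rep_omega1 \<alpha>)"
    by (auto simp: underS_def less_omega1_def less_eq_omega1_def Rep_omega1_inject)
  ultimately show ?thesis
    by (meson countable_subset countable_image_inj_on Rep_omega1_inject inj_onI)
qed


definition limit_ordinal :: "omega1 \<Rightarrow> bool" where
  "limit_ordinal \<beta> \<longleftrightarrow> (\<exists>\<alpha>. \<alpha> < \<beta>) \<and> (\<forall>\<alpha><\<beta>. \<exists>\<gamma>. \<alpha> < \<gamma> \<and> \<gamma> < \<beta>)"

definition club :: "omega1 set \<Rightarrow> bool" where
  "club C \<longleftrightarrow>
     (\<forall>\<alpha>. \<exists>\<gamma>\<in>C. \<alpha> < \<gamma>) \<and>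
     (\<forall>\<beta>. limit_ordinal \<beta> \<and> (\<forall>\<alpha><\<beta>. \<exists>\<gamma>\<in>C. \<alpha> < \<gamma> \<and> \<gamma> < \<beta>) \<longrightarrow> \<beta> \<in> C)"

definition stationary :: "omega1 set \<Rightarrow> bool" where
  "stationary S \<longleftrightarrow> (\<forall>C. club C \<longrightarrow> S \<inter> C \<noteq> {})"

definition diamond :: bool where
  "diamond \<longleftrightarrow>
     (\<exists>A :: omega1 \<Rightarrow> omega1 set.
        (\<forall>\<alpha>. A \<alpha> \<subseteq> {..<\<alpha>}) \<and>
        (\<forall>X. stationary {\<alpha>. X \<inter> {..<\<alpha>} = A \<alpha>}))"


text \<open>
  An element of \<open>\<omega>\<^sub>1\<close> to the power \<open>< \<omega>\<^sub>1\<close> is a partial function whose domain is a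
  countable ordinal. The initial segment relation is \<open>\<sigma> \<subseteq>\<^sub>m \<tau>\<close>, the initial segment
  of \<open>\<sigma>\<close> of length \<open>\<alpha>\<close> is \<open>\<sigma> |` {..<\<alpha>}\<close>, and the extension of \<open>\<sigma>\<close> by one more
  entry \<open>i\<close> is \<open>\<sigma>(\<alpha> \<mapsto> i)\<close> where \<open>dom \<sigma> = {..<\<alpha>}\<close>.
\<close>

type_synonym omega1_seq = "omega1 \<rightharpoonup> omega1"

definition seqs :: "omega1_seq set" where
  "seqs = {\<sigma>. \<exists>\<alpha>. dom \<sigma> = {..<\<alpha>}}"

definition level :: "omega1_seq set \<Rightarrow> omega1 \<Rightarrow> omega1_seq set" where
  "level T \<alpha> = {\<sigma>\<in>T. dom \<sigma> = {..<\<alpha>}}"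

definition below_level :: "omega1_seq set \<Rightarrow> omega1 \<Rightarrow> omega1_seq set" where
  "below_level T \<beta> = (\<Union>\<alpha><\<beta>. level T \<alpha>)"

text \<open>The height is the least ordinal whose level is empty; it is \<open>\<omega>\<^sub>1\<close> iff no level is empty.\<close>

definition is_tree :: "omega1_seq set \<Rightarrow> bool" where
  "is_tree T \<longleftrightarrow>
     T \<subseteq> seqs \<and>
     (\<forall>\<tau>\<in>T. \<forall>\<sigma>\<in>seqs. \<sigma> \<subseteq>\<^sub>m \<tau> \<longrightarrow> \<sigma> \<in> T) \<and>
     (\<forall>\<alpha>. level T \<alpha> \<noteq> {})"

definition normal :: "omega1_seq set \<Rightarrow> bool" where
  "normal T \<longleftrightarrow> (\<forall>\<sigma>\<in>T. \<forall>\<alpha>. \<exists>\<tau>\<in>T. \<sigma> \<subseteq>\<^sub>m \<tau> \<and> {..<\<alpha>} \<subseteq> dom \<tau>)"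

definition splitting :: "omega1_seq set \<Rightarrow> bool" where
  "splitting T \<longleftrightarrow>
     (\<forall>\<alpha>. \<forall>\<sigma>\<in>level T \<alpha>. \<exists>i j. i \<noteq> j \<and> \<sigma>(\<alpha> \<mapsto> i) \<in> T \<and> \<sigma>(\<alpha> \<mapsto> j) \<in> T)"

text \<open>
  A branch is a maximal chain; it is cofinal if it meets every nonempty level.
  This is applied both to \<open>T\<close> itself and to \<open>below_level T \<beta>\<close>.
\<close>

definition cofinal_branches :: "omega1_seq set \<Rightarrow> omega1_seq set set" where
  "cofinal_branches S =
     {b. pred_on.maxchain S (\<subseteq>\<^sub>m) b \<and> (\<forall>\<alpha>. level S \<alpha> \<noteq> {} \<longrightarrow> b \<inter> level S \<alpha> \<noteq> {})}"

definition vanishing_branch :: "omega1_seq set \<Rightarrow> omega1 \<Rightarrow> omega1_seq set \<Rightarrow> bool" where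
  "vanishing_branch T \<beta> b \<longleftrightarrow>
     b \<in> cofinal_branches (below_level T \<beta>) \<and> \<not> (\<exists>\<tau>\<in>level T \<beta>. \<forall>\<sigma>\<in>b. \<sigma> \<subseteq>\<^sub>m \<tau>)"

definition full :: "omega1_seq set \<Rightarrow> bool" where
  "full T \<longleftrightarrow> (\<forall>\<beta>. limit_ordinal \<beta> \<longrightarrow> (\<exists>\<^sub>\<le>\<^sub>1 b. vanishing_branch T \<beta> b))"

end

theory Submission
  imports Defs
begin

text \<open>
  Identify subsets of \<open>\<omega>\<^sub>1\<close> with their characteristic functions, and call a family \<open>F\<close> of such subsets
  closed if every \<open>X \<notin> F\<close> has an initial segment that is not an initial segment of any member
  of \<open>F\<close>. Given a diamond sequence \<open>A\<close>, let \<open>T\<close> consist of all countable binary sequences none of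
  whose restrictions to a limit \<open>\<beta>\<close> equals \<open>A \<beta>\<close>, except that \<open>A \<beta>\<close> is tolerated when it is an
  initial segment of a member of \<open>F\<close>. At every limit level at most one branch is cut off, so \<open>T\<close> is
  full; since infinitely many coordinates are free before the next limit, a Cantor diagonal argument
  avoids countably many forbidden sequences at once, so \<open>T\<close> is normal. Members of \<open>F\<close> are cofinal
  branches, and by the guessing property any other branch through \<open>T\<close> is cut off somewhere. It
  remains to find closed families of each required cardinality.
\<close>

subsection \<open>Countable ordinals\<close>

lemma uncountable_UNIV_omega1: "uncountable (UNIV :: omega1 set)"
proof
  assume "countable (UNIV :: omega1 set)"
  then have "|UNIV :: omega1 set| \<le>o natLeq"
    by (metis card_of_nat card_of_ordLeqI countable_def ordLeq_ordIso_trans UNIV_I)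
  then have "cardSuc natLeq \<le>o natLeq"
    using card_of_UNIV_omega1 ordIso_ordLeq_trans ordIso_symmetric by blast
  moreover have "natLeq <o cardSuc natLeq"
    by (rule cardSuc_greater [OF natLeq_Card_order])
  ultimately show False
    using not_ordLess_ordLeq by blast
qed

text \<open>If \<open>B\<close> had no strict upper bound, every ordinal would lie at or below a
  member of \<open>B\<close>, so \<omega>1 would be a countable union of countable sets.\<close>

lemma countable_strict_upper_bound:
  fixes B :: "omega1 set"
  assumes "countable B"
  shows "\<exists>\<gamma>. \<forall>\<alpha>\<in>B. \<alpha> < \<gamma>"
proof (rule ccontr)
  assume *: "\<nexists>\<gamma>. \<forall>\<alpha>\<in>B. \<alpha> < \<gamma>"
  have "countable (\<Union>\<alpha>\<in>B. insert \<alpha> {..<\<alpha>})"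
    using assms by (simp add: countable_lessThan_omega1)
  moreover have "(\<Union>\<alpha>\<in>B. insert \<alpha> {..<\<alpha>}) = UNIV"
    using * by (auto simp: not_less le_less)
  ultimately show False
    using uncountable_UNIV_omega1 by simp
qed

definition osucc :: "omega1 \<Rightarrow> omega1" where
  "osucc \<alpha> = (LEAST \<gamma>. \<alpha> < \<gamma>)"

lemma less_osucc [simp]: "\<alpha> < osucc \<alpha>"
  unfolding osucc_def using countable_strict_upper_bound [of "{\<alpha>}"] by (auto intro: LeastI)

lemma osucc_neq [simp]: "osucc \<alpha> \<noteq> \<alpha>" "\<alpha> \<noteq> osucc \<alpha>"
  using less_osucc [of \<alpha>] by (metis less_irrefl)+

lemma less_osucc_iff: "\<beta> < osucc \<alpha> \<longleftrightarrow> \<beta> \<le> \<alpha>"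
  by (metis Least_le leD le_less_trans less_osucc not_le osucc_def)

lemma not_limit_ordinal_osucc: "\<not> limit_ordinal (osucc \<alpha>)"
  unfolding limit_ordinal_def by (metis less_osucc less_osucc_iff leD)

lemma ex_limit_ordinal_greater: "\<exists>\<beta>>\<alpha>. limit_ordinal \<beta>"
proof -
  define f where "f n = (osucc ^^ n) \<alpha>" for n
  \<comment> \<open>The supremum of the \<omega> iterated successors of \<open>\<alpha>\<close>;
    minimality puts some \<open>f n\<close> at or above any smaller ordinal.\<close>
  define \<beta> where "\<beta> = (LEAST \<gamma>. \<forall>n. f n < \<gamma>)"
  have "\<exists>\<gamma>. \<forall>n. f n < \<gamma>"
    using countable_strict_upper_bound [of "range f"] by auto
  then have f_less: "f n < \<beta>" for n
    unfolding \<beta>_def by (rule LeastI2_ex) simp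
  have "\<exists>\<gamma>. \<delta> < \<gamma> \<and> \<gamma> < \<beta>" if "\<delta> < \<beta>" for \<delta>
  proof -
    have "\<not> (\<forall>n. f n < \<delta>)"
      using that not_less_Least unfolding \<beta>_def by blast
    then obtain n where "\<delta> \<le> f n"
      by (auto simp: not_less)
    then have "\<delta> < f (Suc n)"
      by (simp add: f_def) (metis le_less_trans less_osucc)
    then show ?thesis
      using f_less by blast
  qed
  then show ?thesis
    using f_less [of 0] unfolding limit_ordinal_def f_def by auto
qed

lemma infinite_interval_limit_ordinal:
  assumes "limit_ordinal \<beta>" "\<delta> < \<beta>"
  shows "infinite {\<delta>..<\<beta>}"
proof
  assume "finite {\<delta>..<\<beta>}"
  then have "Max {\<delta>..<\<beta>} \<in> {\<delta>..<\<beta>}"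
    using assms(2) by (intro Max_in) auto
  then obtain \<gamma> where "Max {\<delta>..<\<beta>} < \<gamma>" "\<gamma> \<in> {\<delta>..<\<beta>}"
    using assms(1) unfolding limit_ordinal_def by fastforce
  then show False
    using \<open>finite {\<delta>..<\<beta>}\<close> by (metis Max_ge leD)
qed

text \<open>Cantor's diagonal argument along an injective sequence in \<open>D\<close>: the
  \<open>n\<close>-th point decides against the \<open>n\<close>-th member of
  \<open>K\<close>.\<close>

lemma ex_subset_not_in_countable:
  assumes "infinite D" "countable K"
  shows "\<exists>X\<subseteq>D. X \<notin> K"
\<comment> \<open>\<open>from_nat_into\<close> enumerates \<open>K\<close> only when
  \<open>K\<close> is nonempty.\<close>
proof (cases "K = {}")
  case False
  obtain f :: "nat \<Rightarrow> 'a" where f: "inj f" "range f \<subseteq> D"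
    using assms(1) infinite_countable_subset by blast
  define X where "X = {f n | n. f n \<notin> from_nat_into K n}"
  have "X \<noteq> from_nat_into K n" for n
    unfolding X_def using injD [OF f(1)] by blast
  then have "X \<notin> K"
    using from_nat_into_surj [OF assms(2)] by blast
  moreover have "X \<subseteq> D"
    using f(2) unfolding X_def by auto
  ultimately show ?thesis
    by blast
qed auto

subsection \<open>Binary sequences\<close>

text \<open>The letters depend on the position so that no two fixed ordinals need to be named.\<close>

definition char_seq :: "omega1 set \<Rightarrow> omega1 \<Rightarrow> omega1_seq" where
  "char_seq X \<alpha> = (\<lambda>\<xi>. if \<xi> < \<alpha> then Some (if \<xi> \<in> X then osucc \<xi> else \<xi>) else None)"

lemma dom_char_seq [simp]: "dom (char_seq X \<alpha>) = {..<\<alpha>}"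
  by (auto simp: char_seq_def split: if_splits)

lemma lessThan_omega1_subset_iff [simp]: "{..<\<alpha>} \<subseteq> {..<\<beta>} \<longleftrightarrow> \<alpha> \<le> (\<beta> :: omega1)"
  by (metis lessThan_iff less_le_trans linorder_not_less order_less_irrefl subset_iff)

lemma lessThan_omega1_eq_iff [simp]: "{..<\<alpha>} = {..<\<beta>} \<longleftrightarrow> \<alpha> = (\<beta> :: omega1)"
  by (metis antisym lessThan_omega1_subset_iff order_refl)

lemma char_seq_map_le_iff:
  "char_seq X \<alpha> \<subseteq>\<^sub>m char_seq Y \<beta> \<longleftrightarrow> \<alpha> \<le> \<beta> \<and> X \<inter> {..<\<alpha>} = Y \<inter> {..<\<alpha>}"
proof
  assume le: "char_seq X \<alpha> \<subseteq>\<^sub>m char_seq Y \<beta>"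
  then have "\<alpha> \<le> \<beta>"
    using map_le_implies_dom_le by fastforce
  moreover have "\<xi> \<in> X \<longleftrightarrow> \<xi> \<in> Y" if "\<xi> < \<alpha>" for \<xi>
  proof -
    have "char_seq X \<alpha> \<xi> = char_seq Y \<beta> \<xi>"
      using le that unfolding map_le_def dom_char_seq by blast
    then show ?thesis
      using that \<open>\<alpha> \<le> \<beta>\<close> by (auto simp: char_seq_def split: if_splits)
  qed
  ultimately show "\<alpha> \<le> \<beta> \<and> X \<inter> {..<\<alpha>} = Y \<inter> {..<\<alpha>}"
    by auto
next
  assume *: "\<alpha> \<le> \<beta> \<and> X \<inter> {..<\<alpha>} = Y \<inter> {..<\<alpha>}"
  show "char_seq X \<alpha> \<subseteq>\<^sub>m char_seq Y \<beta>"
    unfolding map_le_def dom_char_seq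
  proof
    fix \<xi> assume \<xi>: "\<xi> \<in> {..<\<alpha>}"
    then have "\<xi> \<in> X \<longleftrightarrow> \<xi> \<in> Y"
      using * by blast
    moreover have "\<xi> < \<alpha>" "\<xi> < \<beta>"
      using \<xi> * by (auto intro: less_le_trans)
    ultimately show "char_seq X \<alpha> \<xi> = char_seq Y \<beta> \<xi>"
      by (simp add: char_seq_def)
  qed
qed

lemma char_seq_eq_iff:
  "char_seq X \<alpha> = char_seq Y \<beta> \<longleftrightarrow> \<alpha> = \<beta> \<and> X \<inter> {..<\<alpha>} = Y \<inter> {..<\<alpha>}"
  by (metis antisym char_seq_map_le_iff map_le_antisym map_le_refl)

text \<open>Initial segments of characteristic sequences are again characteristic sequences of the
  same set, which gives downward closure of the tree.\<close>

lemma map_le_char_seqD: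
  assumes "\<sigma> \<subseteq>\<^sub>m char_seq X \<alpha>" "dom \<sigma> = {..<\<beta>}"
  shows "\<beta> \<le> \<alpha>" "\<sigma> = char_seq X \<beta>"
proof -
  show le: "\<beta> \<le> \<alpha>"
    using map_le_implies_dom_le [OF assms(1)] assms(2) by simp
  have "char_seq X \<beta> \<subseteq>\<^sub>m char_seq X \<alpha>"
    using le by (simp add: char_seq_map_le_iff)
  then show "\<sigma> = char_seq X \<beta>"
    using assms by (intro map_le_antisym) (auto simp: map_le_def)
qed

text \<open>The two letters available at position \<alpha>, one for membership and one for
  non-membership, provide the two successors needed for splitting.\<close>

lemma char_seq_upd:
  "(char_seq X \<alpha>)(\<alpha> \<mapsto> osucc \<alpha>) = char_seq (insert \<alpha> X) (osucc \<alpha>)"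
  "(char_seq X \<alpha>)(\<alpha> \<mapsto> \<alpha>) = char_seq (X - {\<alpha>}) (osucc \<alpha>)"
  by (rule ext, auto simp: char_seq_def less_osucc_iff)+

subsection \<open>The tree\<close>

text \<open>The bound includes \<alpha> itself, so a sequence of limit length is also tested against
  the guess at its own length.\<close>

definition admissible ::
  "(omega1 \<Rightarrow> omega1 set) \<Rightarrow> omega1 set set \<Rightarrow> omega1 set \<Rightarrow> omega1 \<Rightarrow> bool" where
  "admissible A F X \<alpha> \<longleftrightarrow>
     (\<forall>\<beta>\<le>\<alpha>. limit_ordinal \<beta> \<and> X \<inter> {..<\<beta>} = A \<beta> \<longrightarrow> (\<exists>Y\<in>F. Y \<inter> {..<\<beta>} = A \<beta>))"

text \<open>The set \<open>L\<close> of permitted lengths makes one analysis of branches serve both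
  the whole tree, \<open>L = UNIV\<close>, and its part below level \<beta>,
  \<open>L = {..<\<beta>}\<close>.\<close>

definition char_tree ::
  "(omega1 \<Rightarrow> omega1 set) \<Rightarrow> omega1 set set \<Rightarrow> omega1 set \<Rightarrow> omega1_seq set" where
  "char_tree A F L = {char_seq X \<alpha> | X \<alpha>. \<alpha> \<in> L \<and> admissible A F X \<alpha>}"

lemma admissible_mono: "admissible A F X \<alpha> \<Longrightarrow> \<beta> \<le> \<alpha> \<Longrightarrow> admissible A F X \<beta>"
  by (auto simp: admissible_def)

lemma admissible_cong:
  assumes "X \<inter> {..<\<alpha>} = Y \<inter> {..<\<alpha>}"
  shows "admissible A F X \<alpha> \<longleftrightarrow> admissible A F Y \<alpha>"
proof -
  have "X \<inter> {..<\<beta>} = Y \<inter> {..<\<beta>}" if "\<beta> \<le> \<alpha>" for \<beta>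
    using assms that by (auto dest: less_le_trans)
  then show ?thesis
    by (auto simp: admissible_def)
qed

text \<open>Constraints occur only at limit ordinals and \<open>osucc \<alpha>\<close> is not one,
  so membership of \<alpha> can be chosen freely.\<close>

lemma admissible_osucc:
  assumes "admissible A F X \<alpha>" "X \<inter> {..<\<alpha>} = Y \<inter> {..<\<alpha>}"
  shows "admissible A F Y (osucc \<alpha>)"
proof -
  have "admissible A F Y \<alpha>"
    using assms admissible_cong by blast
  then show ?thesis
    unfolding admissible_def by (metis le_less less_osucc_iff not_limit_ordinal_osucc)
qed

text \<open>A node does not determine \<open>X\<close> above its length, but admissibility depends
  only on the part of \<open>X\<close> below it.\<close>

lemma char_seq_in_char_tree_iff:
  "char_seq X \<alpha> \<in> char_tree A F L \<longleftrightarrow> \<alpha> \<in> L \<and> admissible A F X \<alpha>"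
proof
  assume "char_seq X \<alpha> \<in> char_tree A F L"
  then obtain Y where "\<alpha> \<in> L" "admissible A F Y \<alpha>" "X \<inter> {..<\<alpha>} = Y \<inter> {..<\<alpha>}"
    unfolding char_tree_def mem_Collect_eq char_seq_eq_iff by metis
  then show "\<alpha> \<in> L \<and> admissible A F X \<alpha>"
    using admissible_cong by blast
qed (unfold char_tree_def, blast)

text \<open>The core of normality. No constraint falls strictly between \<delta> and the next limit
  \<beta>, and the coordinates in between suffice to differ from all later guesses at once.\<close>

lemma admissible_extend:
  assumes "admissible A F X \<delta>" "\<delta> \<le> \<alpha>"
  shows "\<exists>Y. Y \<inter> {..<\<delta>} = X \<inter> {..<\<delta>} \<and> admissible A F Y \<alpha>"
proof (cases "\<exists>\<beta>. limit_ordinal \<beta> \<and> \<delta> < \<beta>")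
  case True
  define \<beta> where "\<beta> = (LEAST \<beta>. limit_ordinal \<beta> \<and> \<delta> < \<beta>)"
  define D where "D = {\<delta>..<\<beta>}"
  have \<beta>: "limit_ordinal \<beta>" "\<delta> < \<beta>"
    unfolding \<beta>_def using LeastI_ex [OF True] by auto
  have \<beta>_le: "\<beta> \<le> \<gamma>" if "limit_ordinal \<gamma>" "\<delta> < \<gamma>" for \<gamma>
    unfolding \<beta>_def using that by (simp add: Least_le)
  have "{..\<alpha>} = insert \<alpha> {..<\<alpha>}"
    by auto
  \<comment> \<open>Only the countably many guesses up to \<alpha> matter, and it is enough to avoid
    their traces on \<open>D\<close>.\<close>
  then have "countable ((\<lambda>\<gamma>. A \<gamma> \<inter> D) ` {..\<alpha>})"
    by (simp add: countable_lessThan_omega1)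
  then obtain Z where Z: "Z \<subseteq> D" "Z \<notin> (\<lambda>\<gamma>. A \<gamma> \<inter> D) ` {..\<alpha>}"
    using ex_subset_not_in_countable infinite_interval_limit_ordinal [OF \<beta>]
    unfolding D_def by meson
  define Y where "Y = X \<inter> {..<\<delta>} \<union> Z"
  have YX: "Y \<inter> {..<\<delta>} = X \<inter> {..<\<delta>}"
    using Z(1) by (fastforce simp: Y_def D_def)
  have "\<exists>W\<in>F. W \<inter> {..<\<gamma>} = A \<gamma>" if \<gamma>: "\<gamma> \<le> \<alpha>" "limit_ordinal \<gamma>" "Y \<inter> {..<\<gamma>} = A \<gamma>" for \<gamma>
  \<comment> \<open>Constraints up to \<delta> are inherited from \<open>X\<close>. A limit beyond
    \<delta> is at least \<beta>, so a match there would make \<open>Z\<close> one of the avoided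
    traces.\<close>
  proof (cases "\<gamma> \<le> \<delta>")
    case True
    then show ?thesis
      using assms(1) admissible_cong [OF YX] \<gamma> unfolding admissible_def by blast
  next
    case False
    then have "D \<subseteq> {..<\<gamma>}"
      using \<beta>_le [OF \<gamma>(2)] by (auto simp: D_def intro: less_le_trans)
    moreover have "Y \<inter> D = Z"
      using Z(1) by (fastforce simp: Y_def D_def)
    ultimately have "A \<gamma> \<inter> D = Z"
      using \<gamma>(3) by blast
    then show ?thesis
      using Z(2) \<gamma>(1) by auto
  qed
  then show ?thesis
    using YX unfolding admissible_def by blast
next
  \<comment> \<open>Impossible, since limit ordinals are unbounded.\<close>
  case False
  then show ?thesis
    using ex_limit_ordinal_greater [of \<delta>] by blast
qed

text \<open>There is no limit ordinal up to zero, so the empty sequence is admissible and extends to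
  any length. Hence no level is empty.\<close>

lemma ex_admissible: "\<exists>X. admissible A F X \<alpha>"
proof -
  define z :: omega1 where "z = (LEAST x. True)"
  have z: "z \<le> \<beta>" for \<beta>
    by (simp add: z_def Least_le)
  then have "admissible A F {} z"
    unfolding admissible_def limit_ordinal_def by (meson leD less_le_trans)
  then show ?thesis
    using admissible_extend z by blast
qed

lemma level_char_tree:
  "level (char_tree A F L) \<alpha> = {char_seq X \<alpha> | X. \<alpha> \<in> L \<and> admissible A F X \<alpha>}"
proof (intro equalityI subsetI)
  fix \<sigma> assume "\<sigma> \<in> level (char_tree A F L) \<alpha>"
  then obtain X \<beta> where "\<sigma> = char_seq X \<beta>" "\<beta> \<in> L" "admissible A F X \<beta>" "dom \<sigma> = {..<\<alpha>}"
    unfolding level_def char_tree_def by blast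
  then show "\<sigma> \<in> {char_seq X \<alpha> | X. \<alpha> \<in> L \<and> admissible A F X \<alpha>}"
    by auto
next
  fix \<sigma> assume "\<sigma> \<in> {char_seq X \<alpha> | X. \<alpha> \<in> L \<and> admissible A F X \<alpha>}"
  then obtain X where "\<sigma> = char_seq X \<alpha>" "\<alpha> \<in> L" "admissible A F X \<alpha>"
    by blast
  then show "\<sigma> \<in> level (char_tree A F L) \<alpha>"
    unfolding level_def by (simp add: char_seq_in_char_tree_iff)
qed

lemma below_level_char_tree: "below_level (char_tree A F UNIV) \<beta> = char_tree A F {..<\<beta>}"
  unfolding below_level_def level_char_tree by (auto simp: char_tree_def)

lemma is_tree_char_tree: "is_tree (char_tree A F UNIV)"
  unfolding is_tree_def
proof (intro conjI ballI allI impI)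
  show "char_tree A F UNIV \<subseteq> seqs"
    by (auto simp: char_tree_def seqs_def)
  show "level (char_tree A F UNIV) \<alpha> \<noteq> {}" for \<alpha>
    using ex_admissible by (auto simp: level_char_tree)
  fix \<tau> \<sigma>
  assume \<tau>: "\<tau> \<in> char_tree A F UNIV" and "\<sigma> \<in> seqs" and le: "\<sigma> \<subseteq>\<^sub>m \<tau>"
  then obtain \<beta> where \<beta>: "dom \<sigma> = {..<\<beta>}"
    by (auto simp: seqs_def)
  from \<tau> obtain X \<alpha> where X: "\<tau> = char_seq X \<alpha>" "admissible A F X \<alpha>"
    by (auto simp: char_tree_def)
  note map_le_char_seqD [OF le [unfolded X(1)] \<beta>]
  then show "\<sigma> \<in> char_tree A F UNIV"
    using admissible_mono [OF X(2)] by (simp add: char_seq_in_char_tree_iff)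
qed

lemma normal_char_tree: "normal (char_tree A F UNIV)"
  unfolding normal_def
proof (intro ballI allI)
  fix \<sigma> \<alpha>
  assume "\<sigma> \<in> char_tree A F UNIV"
  then obtain X \<delta> where \<sigma>: "\<sigma> = char_seq X \<delta>" "admissible A F X \<delta>"
    by (auto simp: char_tree_def)
  then obtain Y where "Y \<inter> {..<\<delta>} = X \<inter> {..<\<delta>}" "admissible A F Y (max \<delta> \<alpha>)"
    using admissible_extend [OF \<sigma>(2) max.cobounded1] by blast
  then have "char_seq Y (max \<delta> \<alpha>) \<in> char_tree A F UNIV" "\<sigma> \<subseteq>\<^sub>m char_seq Y (max \<delta> \<alpha>)"
    by (auto simp: char_seq_in_char_tree_iff char_seq_map_le_iff \<sigma>(1))
  then show "\<exists>\<tau>\<in>char_tree A F UNIV. \<sigma> \<subseteq>\<^sub>m \<tau> \<and> {..<\<alpha>} \<subseteq> dom \<tau>"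
    by (intro bexI [of _ "char_seq Y (max \<delta> \<alpha>)"]) auto
qed

lemma splitting_char_tree: "splitting (char_tree A F UNIV)"
  unfolding splitting_def
proof (intro allI ballI)
  fix \<alpha> \<sigma>
  assume "\<sigma> \<in> level (char_tree A F UNIV) \<alpha>"
  then obtain X where \<sigma>: "\<sigma> = char_seq X \<alpha>" and X: "admissible A F X \<alpha>"
    by (auto simp: level_char_tree)
  have "\<sigma>(\<alpha> \<mapsto> osucc \<alpha>) \<in> char_tree A F UNIV" "\<sigma>(\<alpha> \<mapsto> \<alpha>) \<in> char_tree A F UNIV"
    unfolding \<sigma> char_seq_upd char_seq_in_char_tree_iff
    by (auto intro: admissible_osucc [OF X])
  then show "\<exists>i j. i \<noteq> j \<and> \<sigma>(\<alpha> \<mapsto> i) \<in> char_tree A F UNIV \<and> \<sigma>(\<alpha> \<mapsto> j) \<in> char_tree A F UNIV"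
    using osucc_neq by blast
qed

subsection \<open>Branches\<close>

text \<open>\<open>pred_on.chain\<close> compares by the reflexive closure of the relation, and
  \<open>(\<subseteq>\<^sub>m)\<close> is already reflexive.\<close>

lemma chain_map_le_iff:
  "pred_on.chain S (\<subseteq>\<^sub>m) b \<longleftrightarrow> b \<subseteq> S \<and> (\<forall>\<sigma>\<in>b. \<forall>\<tau>\<in>b. \<sigma> \<subseteq>\<^sub>m \<tau> \<or> \<tau> \<subseteq>\<^sub>m \<sigma>)"
  unfolding pred_on.chain_def by auto (metis map_le_refl)+

text \<open>Levels indexed by \<open>L\<close> are nonempty, so a cofinal branch has a node of each
  length in \<open>L\<close>, and these nodes cohere into a single set \<open>X\<close>.\<close>

lemma cofinal_branches_char_tree:
  assumes no_max: "\<And>\<alpha>. \<alpha> \<in> L \<Longrightarrow> \<exists>\<beta>\<in>L. \<alpha> < \<beta>"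
  shows "cofinal_branches (char_tree A F L) =
    {char_seq X ` L | X. \<forall>\<alpha>\<in>L. admissible A F X \<alpha>}" (is "?B = ?R")
proof (intro equalityI subsetI)
  fix b assume "b \<in> ?B"
  then have chain: "pred_on.chain (char_tree A F L) (\<subseteq>\<^sub>m) b"
    and meets: "\<And>\<alpha>. level (char_tree A F L) \<alpha> \<noteq> {} \<Longrightarrow> b \<inter> level (char_tree A F L) \<alpha> \<noteq> {}"
    unfolding cofinal_branches_def pred_on.maxchain_def by auto
  have sub: "b \<subseteq> char_tree A F L"
    and cmp: "\<And>\<sigma> \<tau>. \<sigma> \<in> b \<Longrightarrow> \<tau> \<in> b \<Longrightarrow> \<sigma> \<subseteq>\<^sub>m \<tau> \<or> \<tau> \<subseteq>\<^sub>m \<sigma>"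
    using chain unfolding chain_map_le_iff by auto
  have ex: "\<exists>X. char_seq X \<alpha> \<in> b" if "\<alpha> \<in> L" for \<alpha>
    using meets [of \<alpha>] ex_admissible that by (auto simp: level_char_tree)
  \<comment> \<open>The union of the branch, decoded: the letter \<open>osucc \<xi>\<close> at
    position \<xi> records membership.\<close>
  define X where "X = {\<xi>. \<exists>\<sigma>\<in>b. \<sigma> \<xi> = Some (osucc \<xi>)}"
  have X_agrees: "X \<inter> {..<\<alpha>} = Y \<inter> {..<\<alpha>}" if Y: "char_seq Y \<alpha> \<in> b" for Y \<alpha>
  proof -
    have "\<xi> \<in> Y" if "\<sigma> \<in> b" "\<sigma> \<xi> = Some (osucc \<xi>)" "\<xi> < \<alpha>" for \<sigma> \<xi>
    proof -
      have "\<xi> \<in> dom \<sigma>" "\<xi> \<in> dom (char_seq Y \<alpha>)"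
        using that by auto
      then have "char_seq Y \<alpha> \<xi> = Some (osucc \<xi>)"
        using cmp [OF that(1) Y] that(2) unfolding map_le_def by metis
      then show ?thesis
        by (auto simp: char_seq_def split: if_splits)
    qed
    moreover have "\<xi> \<in> X" if "\<xi> \<in> Y" "\<xi> < \<alpha>" for \<xi>
    proof -
      have "char_seq Y \<alpha> \<xi> = Some (osucc \<xi>)"
        using that by (simp add: char_seq_def)
      then show ?thesis
        using Y unfolding X_def by blast
    qed
    ultimately show ?thesis
      by (auto simp: X_def)
  qed
  have in_b: "char_seq X \<alpha> \<in> b" if "\<alpha> \<in> L" for \<alpha>
    using ex [OF that] X_agrees by (metis char_seq_eq_iff)
  have "b = char_seq X ` L"
  proof (intro equalityI subsetI)
    fix \<sigma> assume "\<sigma> \<in> b"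
    then obtain Y \<alpha> where "\<sigma> = char_seq Y \<alpha>" "\<alpha> \<in> L"
      using sub by (auto simp: char_tree_def)
    then show "\<sigma> \<in> char_seq X ` L"
      using X_agrees \<open>\<sigma> \<in> b\<close> by (metis char_seq_eq_iff imageI)
  qed (use in_b in auto)
  moreover have "\<forall>\<alpha>\<in>L. admissible A F X \<alpha>"
    using in_b sub char_seq_in_char_tree_iff by blast
  ultimately show "b \<in> ?R"
    by blast
next
  fix b assume "b \<in> ?R"
  then obtain X where b: "b = char_seq X ` L" and X: "\<And>\<alpha>. \<alpha> \<in> L \<Longrightarrow> admissible A F X \<alpha>"
    by auto
  have "b \<subseteq> char_tree A F L"
    using X by (auto simp: b char_seq_in_char_tree_iff)
  then have "pred_on.chain (char_tree A F L) (\<subseteq>\<^sub>m) b"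
    unfolding chain_map_le_iff b by (auto simp: char_seq_map_le_iff)
  \<comment> \<open>Maximality: comparable nodes of equal length coincide, and \<open>b\<close>
    already has a node of each length in \<open>L\<close>.\<close>
  moreover have "c \<subseteq> b" if c: "pred_on.chain (char_tree A F L) (\<subseteq>\<^sub>m) c" "b \<subseteq> c" for c
  proof
    fix \<sigma> assume "\<sigma> \<in> c"
    then obtain Y \<alpha> where \<sigma>: "\<sigma> = char_seq Y \<alpha>" "\<alpha> \<in> L"
      using c(1) unfolding chain_map_le_iff char_tree_def by auto
    then have "char_seq X \<alpha> \<in> c"
      using c(2) b by auto
    then have "\<sigma> = char_seq X \<alpha>"
      using c(1) \<open>\<sigma> \<in> c\<close> unfolding chain_map_le_iff \<sigma>(1)
      by (metis char_seq_eq_iff char_seq_map_le_iff)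
    then show "\<sigma> \<in> b"
      using \<sigma>(2) b by auto
  qed
  moreover have "b \<inter> level (char_tree A F L) \<alpha> \<noteq> {}" if "level (char_tree A F L) \<alpha> \<noteq> {}" for \<alpha>
    using that X by (auto simp: level_char_tree b)
  ultimately show "b \<in> ?B"
    unfolding cofinal_branches_def pred_on.maxchain_def by blast
qed

text \<open>A branch vanishing at \<beta> must follow the single set \<open>A \<beta>\<close>, which
  determines it.\<close>

lemma full_char_tree: "full (char_tree A F UNIV)"
  unfolding full_def
proof (intro allI impI Uniq_I)
  fix \<beta> b c
  assume \<beta>: "limit_ordinal \<beta>"
  have vanishing: "b = char_seq (A \<beta>) ` {..<\<beta>}"
    if "vanishing_branch (char_tree A F UNIV) \<beta> b" for b
  proof -
    have "b \<in> cofinal_branches (char_tree A F {..<\<beta>})"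
      and unbounded: "\<not> (\<exists>\<tau>\<in>level (char_tree A F UNIV) \<beta>. \<forall>\<sigma>\<in>b. \<sigma> \<subseteq>\<^sub>m \<tau>)"
      using that by (auto simp: vanishing_branch_def below_level_char_tree)
    then obtain X where b: "b = char_seq X ` {..<\<beta>}"
      and X: "\<And>\<alpha>. \<alpha> < \<beta> \<Longrightarrow> admissible A F X \<alpha>"
      using \<beta> by (subst (asm) cofinal_branches_char_tree) (auto simp: limit_ordinal_def)
    have "\<forall>\<sigma>\<in>b. \<sigma> \<subseteq>\<^sub>m char_seq X \<beta>"
      by (auto simp: b char_seq_map_le_iff)
    then have "\<not> admissible A F X \<beta>"
      using unbounded by (auto simp: level_char_tree)
    \<comment> \<open>All shorter lengths are admissible, so the violated constraint is the one at
      \<beta> itself.\<close>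
    then have "X \<inter> {..<\<beta>} = A \<beta>"
      using X unfolding admissible_def by (metis le_less order_refl)
    then have "X \<inter> {..<\<alpha>} = A \<beta> \<inter> {..<\<alpha>}" if "\<alpha> < \<beta>" for \<alpha>
      using that by (auto intro: less_trans)
    then show ?thesis
      unfolding b by (intro image_cong refl) (simp add: char_seq_eq_iff)
  qed
  assume "vanishing_branch (char_tree A F UNIV) \<beta> b" "vanishing_branch (char_tree A F UNIV) \<beta> c"
  then show "b = c"
    using vanishing by metis
qed

subsection \<open>Closed families\<close>

text \<open>Closedness in the topology on the power set of \<omega>1 whose basic open sets prescribe
  a countable initial segment.\<close>

definition closed_family :: "omega1 set set \<Rightarrow> bool" where
  "closed_family F \<longleftrightarrow> (\<forall>X. X \<notin> F \<longrightarrow> (\<exists>\<alpha>. \<forall>Y\<in>F. X \<inter> {..<\<alpha>} \<noteq> Y \<inter> {..<\<alpha>}))"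

text \<open>Lets stationarity supply a correct guess at a limit ordinal beyond any given
  bound.\<close>

lemma club_limit_ordinals_ge: "club {\<beta>. limit_ordinal \<beta> \<and> \<alpha> \<le> \<beta>}"
  unfolding club_def
proof (intro conjI allI impI)
  fix \<gamma>
  obtain \<beta> where "limit_ordinal \<beta>" "max \<alpha> \<gamma> < \<beta>"
    using ex_limit_ordinal_greater by blast
  then show "\<exists>\<beta>\<in>{\<beta>. limit_ordinal \<beta> \<and> \<alpha> \<le> \<beta>}. \<gamma> < \<beta>"
    by auto
next
  fix \<beta>
  assume *: "limit_ordinal \<beta> \<and>
    (\<forall>\<gamma><\<beta>. \<exists>\<delta>\<in>{\<delta>. limit_ordinal \<delta> \<and> \<alpha> \<le> \<delta>}. \<gamma> < \<delta> \<and> \<delta> < \<beta>)"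
  then obtain \<delta> where "\<alpha> \<le> \<delta>" "\<delta> < \<beta>"
    unfolding limit_ordinal_def by blast
  with * show "\<beta> \<in> {\<beta>. limit_ordinal \<beta> \<and> \<alpha> \<le> \<beta>}"
    by auto
qed

text \<open>A member of \<open>F\<close> is its own witness for the exception. If \<open>X\<close>
  is outside \<open>F\<close>, some \<alpha> separates it from all of \<open>F\<close>; a correct
  guess of \<open>X\<close> at a limit \<beta> above \<alpha> would then need a member of
  \<open>F\<close> agreeing with \<open>X\<close> up to \<beta>.\<close>

lemma all_admissible_iff:
  assumes A: "\<And>X. stationary {\<alpha>. X \<inter> {..<\<alpha>} = A \<alpha>}" and F: "closed_family F"
  shows "(\<forall>\<alpha>. admissible A F X \<alpha>) \<longleftrightarrow> X \<in> F"
proof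
  assume X: "\<forall>\<alpha>. admissible A F X \<alpha>"
  show "X \<in> F"
  proof (rule ccontr)
    assume "X \<notin> F"
    then obtain \<alpha> where \<alpha>: "\<And>Y. Y \<in> F \<Longrightarrow> X \<inter> {..<\<alpha>} \<noteq> Y \<inter> {..<\<alpha>}"
      using F unfolding closed_family_def by meson
    have "\<exists>\<beta>. X \<inter> {..<\<beta>} = A \<beta> \<and> limit_ordinal \<beta> \<and> \<alpha> \<le> \<beta>"
      using A [of X] club_limit_ordinals_ge [of \<alpha>] unfolding stationary_def by blast
    then obtain \<beta> where \<beta>: "X \<inter> {..<\<beta>} = A \<beta>" "limit_ordinal \<beta>" "\<alpha> \<le> \<beta>"
      by blast
    have "admissible A F X \<beta>"
      using X by blast
    then obtain Y where Y: "Y \<in> F" "Y \<inter> {..<\<beta>} = A \<beta>"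
      using \<beta>(1,2) unfolding admissible_def by blast
    have "{..<\<alpha>} = {..<\<beta>} \<inter> {..<\<alpha>}"
      using \<beta>(3) by auto
    then show False
      using \<alpha> [OF Y(1)] Y(2) \<beta>(1) by (metis inf_assoc)
  qed
qed (auto simp: admissible_def)

lemma ex_tree_of_closed_family:
  assumes "diamond" "closed_family F"
  shows "\<exists>T. is_tree T \<and> normal T \<and> full T \<and> splitting T \<and> |cofinal_branches T| =o |F|"
proof -
  obtain A where A: "\<And>X. stationary {\<alpha>. X \<inter> {..<\<alpha>} = A \<alpha>}"
    using assms(1) unfolding diamond_def by blast
  have "cofinal_branches (char_tree A F UNIV) = (\<lambda>X. range (char_seq X)) ` F"
    by (subst cofinal_branches_char_tree)
      (auto simp: all_admissible_iff [OF A assms(2)] intro: less_osucc)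
  moreover have "inj_on (\<lambda>X. range (char_seq X)) F"
  proof (rule inj_onI)
    fix X Y
    assume eq: "range (char_seq X) = range (char_seq Y)"
    have "X \<inter> {..<\<alpha>} = Y \<inter> {..<\<alpha>}" for \<alpha>
    proof -
      have "char_seq X \<alpha> \<in> range (char_seq Y)"
        using eq by blast
      then show ?thesis
        by (auto simp: char_seq_eq_iff)
    qed
    then show "X = Y"
      by (metis IntI Int_iff lessThan_iff less_osucc subsetI subset_antisym)
  qed
  ultimately have "|cofinal_branches (char_tree A F UNIV)| =o |F|"
    by (metis card_of_ordIso bij_betw_imageI ordIso_symmetric)
  then show ?thesis
    using is_tree_char_tree normal_char_tree full_char_tree splitting_char_tree by blast
qed

section \<open>Closed families of the required cardinalities\<close>

text \<open>Choose one point of difference from each member of \<open>F\<close>; countably many such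
  points are bounded in \<omega>1.\<close>

lemma closed_family_countable:
  assumes "countable F"
  shows "closed_family F"
  unfolding closed_family_def
proof (intro allI impI)
  fix X assume "X \<notin> F"
  then have "X \<noteq> Y" if "Y \<in> F" for Y
    using that by auto
  then have "\<exists>\<xi>. (\<xi> \<in> X) \<noteq> (\<xi> \<in> Y)" if "Y \<in> F" for Y
    using that by (metis set_eqI)
  then obtain d where d: "\<And>Y. Y \<in> F \<Longrightarrow> (d Y \<in> X) \<noteq> (d Y \<in> Y)"
    by metis
  obtain \<alpha> where \<alpha>: "\<And>Y. Y \<in> F \<Longrightarrow> d Y < \<alpha>"
    using countable_strict_upper_bound [of "d ` F"] assms by auto
  have "X \<inter> {..<\<alpha>} \<noteq> Y \<inter> {..<\<alpha>}" if "Y \<in> F" for Y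
    using d [OF that] \<alpha> [OF that] by blast
  then show "\<exists>\<alpha>. \<forall>Y\<in>F. X \<inter> {..<\<alpha>} \<noteq> Y \<inter> {..<\<alpha>}"
    by blast
qed

text \<open>Two distinct points of \<open>X\<close> below a common bound rule out every
  subsingleton. The empty set has to belong to the family because it is a limit of
  singletons.\<close>

lemma closed_family_subsingletons: "closed_family (insert {} (range (\<lambda>\<xi>. {\<xi>})))"
  unfolding closed_family_def
proof (intro allI impI)
  fix X :: "omega1 set"
  assume "X \<notin> insert {} (range (\<lambda>\<xi>. {\<xi>}))"
  then obtain \<xi> \<eta> where X: "\<xi> \<in> X" "\<eta> \<in> X" "\<xi> \<noteq> \<eta>"
    by blast
  have "X \<inter> {..<osucc (max \<xi> \<eta>)} \<noteq> Y \<inter> {..<osucc (max \<xi> \<eta>)}"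
    if "Y \<in> insert {} (range (\<lambda>\<xi>. {\<xi>}))" for Y
  proof -
    have "\<xi> \<in> X \<inter> {..<osucc (max \<xi> \<eta>)}" "\<eta> \<in> X \<inter> {..<osucc (max \<xi> \<eta>)}"
      using X by (auto simp: less_osucc_iff)
    then have "X \<inter> {..<osucc (max \<xi> \<eta>)} = Y \<inter> {..<osucc (max \<xi> \<eta>)} \<Longrightarrow> \<xi> \<in> Y \<and> \<eta> \<in> Y"
      by blast
    then show ?thesis
      using X(3) that by auto
  qed
  then show "\<exists>\<alpha>. \<forall>Y\<in>insert {} (range (\<lambda>\<xi>. {\<xi>})). X \<inter> {..<\<alpha>} \<noteq> Y \<inter> {..<\<alpha>}"
    by blast
qed

text \<open>Covers the finite cardinals and \<omega> together, using singletons of distinct ordinals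
  as the members.\<close>

lemma ex_closed_family_countable:
  fixes N :: "nat set"
  shows "\<exists>F. closed_family F \<and> |F| =o |N|"
proof -
  obtain g :: "nat \<Rightarrow> omega1" where "inj g"
    using infinite_countable_subset [OF uncountable_infinite [OF uncountable_UNIV_omega1]] by blast
  then have "bij_betw (\<lambda>n. {g n}) N ((\<lambda>n. {g n}) ` N)"
    by (intro bij_betw_imageI) (auto simp: inj_on_def)
  then have "|(\<lambda>n. {g n}) ` N| =o |N|"
    using card_of_ordIso ordIso_symmetric by blast
  moreover have "closed_family ((\<lambda>n. {g n}) ` N)"
    by (rule closed_family_countable) auto
  ultimately show ?thesis
    by blast
qed

text \<open>There are as many singletons as ordinals, and adding one element to an infinite set
  preserves its cardinality.\<close>

lemma card_of_subsingletons:
  "|insert {} (range (\<lambda>\<xi> :: omega1. {\<xi>}))| =o cardSuc natLeq"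
proof -
  let ?S = "range (\<lambda>\<xi> :: omega1. {\<xi>})"
  have "bij_betw (\<lambda>\<xi> :: omega1. {\<xi>}) UNIV ?S"
    by (intro bij_betw_imageI) (auto simp: inj_on_def)
  then have S: "|?S| =o |UNIV :: omega1 set|"
    using card_of_ordIso ordIso_symmetric by blast
  moreover have "infinite (UNIV :: omega1 set)"
    using uncountable_UNIV_omega1 countable_finite by blast
  ultimately have inf: "infinite ?S"
    using card_of_ordIso_finite by blast
  have "|?S| =o |?S \<union> {{}}|"
    using infinite_imp_bij_betw2 [OF inf, of "{}"] unfolding card_of_ordIso .
  then have "|insert {} ?S| =o |?S|"
    using ordIso_symmetric by fastforce
  then show ?thesis
    by (rule ordIso_transitive [OF _ ordIso_transitive [OF S card_of_UNIV_omega1]])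
qed

lemma card_of_UNIV_omega1_set: "|UNIV :: omega1 set set| =o ctwo ^c cardSuc natLeq"
proof -
  have "|Pow (UNIV :: omega1 set)| =o |Func (UNIV :: omega1 set) (UNIV :: bool set)|"
    by (rule card_of_Pow_Func)
  then have "|UNIV :: omega1 set set| =o ctwo ^c |UNIV :: omega1 set|"
    by (simp add: cexp_def ctwo_def Field_card_of)
  also have "ctwo ^c |UNIV :: omega1 set| =o ctwo ^c cardSuc natLeq"
    by (rule cexp_cong2 [OF card_of_UNIV_omega1 Card_order_ctwo card_of_Card_order])
  finally show ?thesis .
qed

theorem theorem6p2:
  fixes \<nu> :: "'k rel"
  assumes "diamond"
    and "Card_order \<nu>"
    and "(\<exists>n :: nat. \<nu> =o |{..<n}| ) \<or> \<nu> =o natLeq \<or> \<nu> =o cardSuc natLeq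
         \<or> \<nu> =o ctwo ^c cardSuc natLeq"
  shows "\<exists>T. is_tree T \<and> normal T \<and> full T \<and> splitting T \<and> |cofinal_branches T| =o \<nu>"
proof -
  have "\<exists>F. closed_family F \<and> |F| =o \<nu>"
    using assms(3)
  \<comment> \<open>The families are: countably many singletons for \<nu> finite or \<omega>, all
    subsingletons for \<omega>1, and the whole power set, which is vacuously closed, for the last
    case.\<close>
  proof (elim disjE exE)
    fix n :: nat
    assume "\<nu> =o |{..<n}|"
    then show ?thesis
      using ex_closed_family_countable ordIso_symmetric ordIso_transitive by meson
  next
    assume "\<nu> =o natLeq"
    then have "|UNIV :: nat set| =o \<nu>"
      using card_of_nat ordIso_symmetric ordIso_transitive by blast
    then show ?thesis
      using ex_closed_family_countable ordIso_transitive by meson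
  next
    assume "\<nu> =o cardSuc natLeq"
    then show ?thesis
      using closed_family_subsingletons card_of_subsingletons ordIso_symmetric ordIso_transitive
      by meson
  next
    assume "\<nu> =o ctwo ^c cardSuc natLeq"
    moreover have "closed_family UNIV"
      by (simp add: closed_family_def)
    ultimately show ?thesis
      using card_of_UNIV_omega1_set ordIso_symmetric ordIso_transitive by meson
  qed
  then obtain F where "closed_family F" "|F| =o \<nu>"
    by blast
  then show ?thesis
    using ex_tree_of_closed_family [OF assms(1)] ordIso_transitive by meson
qed

end
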